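(* Let $k\ge 2$, $n\ge 4$ and $m\ge 3$ be integers. Then \[ \gamma_{[k]R}(C_m\Box P_n) \le \begin{cases} \frac{m}{5}\bigl(n(k+1)+2k\bigr), & m\equiv 0 \pmod{5},\\[4pt] \frac{m+4}{5}\bigl(n(k+1)+2k\bigr) -(4k+1)-2(k+2)\left\lfloor\frac{n-2}{5}\right\rfloor, & m\equiv 1 \pmod{5},\\[4pt] \frac{m+3}{5}\bigl(n(k+1)+2k\bigr) -3k-(k+3)\left\lfloor\frac{n-2}{5}\right\rfloor, & m\equiv 2 \pmod{5},\\[4pt] \frac{m+2}{5}\bigl(n(k+1)+2k\bigr) -2k-2\left\lfloor\frac{n-2}{5}\right\rfloor, & m\equiv 3 \pmod{5},\\[4pt] \frac{m+1}{5}\bigl(n(k+1)+2k\bigr) -2k, & m\equiv 4 \pmod{5}. \end{cases} \]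
   Context: All graphs are finite and simple. For a vertex $v$ of a graph $G$, $N(v)$ denotes its open neighborhood and $N[v]=N(v)\cup\{v\}$ its closed neighborhood. For $f:V(G)\to\mathbb{N}_0$ and $S\subseteq V(G)$ write $f(S)=\sum_{u\in S}f(u)$. For a positive integer $k$, a $[k]$-Roman dominating function of $G$ is a function $f:V(G)\to\{0,1,\dots,k+1\}$ such that every vertex $v$ with $f(v)<k$ satisfies $f(N[v])\ge k+|AN(v)|$, where $AN(v)=\{u\in N(v): f(u)>0\}$. The $[k]$-Roman domination number $\gamma_{[k]R}(G)$ is the minimum of $f(V(G))$ over all $[k]$-Roman dominating functions $f$ of $G$. $C_m\Box P_n$ denotes the Cartesian product of the cycle $C_m$ ($m\ge3$) and the path $P_n$ on $n$ vertices: its vertices are pairs $(i,j)$ with $i\in\{0,\dots,m-1\}$, $j\in\{0,\dots,n-1\}$, and $(i,j)$ is adjacent to $(i',j')$ iff either $j=j'$ and $i-i'\equiv\pm1\pmod m$, or $i=i'$ and $|j-j'|=1$. *)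

theory Defs
  imports Complex_Main "HOL-Number_Theory.Cong" "Graph_Theory.Pair_Digraph"
begin

text \<open>
  Finite simple graphs are represented by the locale \<^locale>\<open>pair_graph\<close>: finite, loop-free
  digraphs without parallel arcs whose arc set is symmetric, so that an edge \<open>uv\<close> is the
  pair of arcs \<open>(u, v)\<close> and \<open>(v, u)\<close>.
\<close>

definition open_nbhd :: "'a pair_pre_digraph \<Rightarrow> 'a \<Rightarrow> 'a set" where
  "open_nbhd G v = {u. (v, u) \<in> parcs G}"

definition closed_nbhd :: "'a pair_pre_digraph \<Rightarrow> 'a \<Rightarrow> 'a set" where
  "closed_nbhd G v = insert v (open_nbhd G v)"

definition active_nbhd :: "'a pair_pre_digraph \<Rightarrow> ('a \<Rightarrow> nat) \<Rightarrow> 'a \<Rightarrow> 'a set" where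
  "active_nbhd G f v = {u \<in> open_nbhd G v. f u > 0}"

text \<open>
  The labellings are total functions, of which only the values on the vertex set matter:
  both the predicate and the weight below ignore all other arguments.
\<close>

definition roman_dominating :: "nat \<Rightarrow> 'a pair_pre_digraph \<Rightarrow> ('a \<Rightarrow> nat) \<Rightarrow> bool" where
  "roman_dominating k G f \<longleftrightarrow>
     (\<forall>v \<in> pverts G. f v \<le> k + 1) \<and>
     (\<forall>v \<in> pverts G. f v < k \<longrightarrow> sum f (closed_nbhd G v) \<ge> k + card (active_nbhd G f v))"

definition roman_domination_number :: "nat \<Rightarrow> 'a pair_pre_digraph \<Rightarrow> nat" where
  "roman_domination_number k G =
     (LEAST w. \<exists>f. roman_dominating k G f \<and> sum f (pverts G) = w)"

definition cycle_graph :: "nat \<Rightarrow> nat pair_pre_digraph" where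
  "cycle_graph m =
     \<lparr> pverts = {..<m},
       parcs = {(i, i'). i < m \<and> i' < m \<and>
         ([int i - int i' = 1] (mod int m) \<or> [int i - int i' = -1] (mod int m))} \<rparr>"

definition path_graph :: "nat \<Rightarrow> nat pair_pre_digraph" where
  "path_graph n =
     \<lparr> pverts = {..<n},
       parcs = {(j, j'). j < n \<and> j' < n \<and> \<bar>int j - int j'\<bar> = 1} \<rparr>"

definition cartesian_product ::
  "'a pair_pre_digraph \<Rightarrow> 'b pair_pre_digraph \<Rightarrow> ('a \<times> 'b) pair_pre_digraph" (infixl "\<box>" 70)
where
  "G \<box> H =
     \<lparr> pverts = pverts G \<times> pverts H,
       parcs = {((i, j), (i', j')).
         (j = j' \<and> j \<in> pverts H \<and> (i, i') \<in> parcs G) \<or>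
         (i = i' \<and> i \<in> pverts G \<and> (j, j') \<in> parcs H)} \<rparr>"

lemma pair_graph_cycle_graph:
  assumes "m \<ge> 2"
  shows "pair_graph (cycle_graph m)"
proof -
  have "parcs (cycle_graph m) \<subseteq> {..<m} \<times> {..<m}"
    by (auto simp: cycle_graph_def)
  then have fin: "finite (parcs (cycle_graph m))"
    by (rule finite_subset) simp
  have flip: "[b - a = - c] (mod p)" if "[a - b = c] (mod p)" for a b c p :: int
    using that by (metis cong_minus_minus_iff minus_diff_eq)
  have "[int j - int i = 1] (mod int m) \<or> [int j - int i = -1] (mod int m)"
    if "[int i - int j = 1] (mod int m) \<or> [int i - int j = -1] (mod int m)" for i j
    using that flip[of "int i" "int j" 1 "int m"] flip[of "int i" "int j" "-1" "int m"] by auto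
  then have sym: "symmetric (cycle_graph m)"
    unfolding symmetric_def cycle_graph_def by (intro symI) simp
  have loop: "fst e \<noteq> snd e" if "e \<in> parcs (cycle_graph m)" for e
    using that assms by (auto simp: cycle_graph_def cong_iff_dvd_diff)
  show ?thesis
    by unfold_locales (use fin sym loop in \<open>auto simp: cycle_graph_def\<close>)
qed

lemma pair_graph_path_graph: "pair_graph (path_graph n)"
proof -
  have "parcs (path_graph n) \<subseteq> {..<n} \<times> {..<n}"
    by (auto simp: path_graph_def)
  then have fin: "finite (parcs (path_graph n))"
    by (rule finite_subset) simp
  have sym: "symmetric (path_graph n)"
    by (auto simp: symmetric_def path_graph_def intro!: symI)
  show ?thesis
    by unfold_locales (use fin sym in \<open>auto simp: path_graph_def\<close>)
qed

lemma pair_graph_cartesian_product: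
  assumes "pair_graph G" "pair_graph H"
  shows "pair_graph (G \<box> H)"
proof -
  interpret G: pair_graph G by fact
  interpret H: pair_graph H by fact
  have "parcs (G \<box> H) \<subseteq> (pverts G \<times> pverts H) \<times> (pverts G \<times> pverts H)"
    by (auto simp: cartesian_product_def dest: G.wellformed' H.wellformed')
  then have fin: "finite (parcs (G \<box> H))"
    by (rule finite_subset) (simp add: G.pair_finite_verts H.pair_finite_verts)
  have sym: "symmetric (G \<box> H)"
    by (auto simp: symmetric_def cartesian_product_def intro!: symI
        dest: G.arcs_symmetric H.arcs_symmetric)
  show ?thesis
    by unfold_locales (use fin sym in \<open>auto simp: cartesian_product_def G.pair_finite_verts
        H.pair_finite_verts dest: G.wellformed' H.wellformed' G.no_loops' H.no_loops'\<close>)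
qed

lemma pverts_cycle_path:
  "(i, j) \<in> pverts (cycle_graph m \<box> path_graph n) \<longleftrightarrow> i < m \<and> j < n"
  by (simp add: cartesian_product_def cycle_graph_def path_graph_def)

lemma parcs_cycle_path:
  assumes "i < m" "i' < m" "j < n" "j' < n"
  shows "((i, j), (i', j')) \<in> parcs (cycle_graph m \<box> path_graph n) \<longleftrightarrow>
    (j = j' \<and> ([int i - int i' = 1] (mod int m) \<or> [int i - int i' = -1] (mod int m))) \<or>
    (i = i' \<and> \<bar>int j - int j'\<bar> = 1)"
  using assms by (auto simp: cartesian_product_def cycle_graph_def path_graph_def)

text \<open>
  The constant function with value \<open>k + 1\<close> is always admissible, so the minimum exists and
  is attained.
\<close>

lemma roman_domination_number_attained:
  "\<exists>f. roman_dominating k G f \<and> sum f (pverts G) = roman_domination_number k G"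
proof -
  have "roman_dominating k G (\<lambda>_. k + 1)"
    by (simp add: roman_dominating_def)
  then show ?thesis
    unfolding roman_domination_number_def
    by (intro LeastI_ex[of "\<lambda>w. \<exists>f. roman_dominating k G f \<and> sum f (pverts G) = w"]) blast
qed

lemma roman_domination_number_le:
  "roman_dominating k G f \<Longrightarrow> roman_domination_number k G \<le> sum f (pverts G)"
  unfolding roman_domination_number_def by (rule Least_le) blast

end

theory Submission
  imports Defs
begin

text \<open>
  A vertex of label at least \<open>k\<close> needs nothing, and any other vertex is satisfied by a neighbour
  of label \<open>k + 1\<close>, or by two neighbours of label \<open>k\<close> since \<open>k \<ge> 2\<close>.
  The points with \<open>i + 2 j \<equiv> 4 (mod 5)\<close> form a perfect code of the infinite grid. If \<open>5\<close> divides
  \<open>m\<close>, labelling them with \<open>k + 1\<close> leaves exactly \<open>m / 5\<close> vertices uncovered in each of the two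
  boundary columns, and these get label \<open>k\<close>. For \<open>m \<equiv> 1, 2, 3 (mod 5)\<close> one inserts one, two or
  three rows into this pattern, labelled almost periodically in \<open>j\<close> with period \<open>5\<close>. For
  \<open>m \<equiv> 4\<close> the code is replaced by \<open>5\<close> dividing the residue \<open>(i - 2 j) mod m\<close>: all cyclic gaps
  within a column are then \<open>5\<close>, except for one gap of \<open>4\<close>, which saves one label \<open>k\<close> in each
  boundary column.
\<close>

section \<open>A sufficient local condition for [k]-Roman domination\<close>

text \<open>An active neighbour raises the demand on \<open>v\<close> by 1, so its net contribution
  is its label minus 1; truncated subtraction gives inactive neighbours 0. No contribution is
  negative, so it is enough to name a convenient subset \<open>U\<close> of the neighbours.\<close>

definition defended :: "nat \<Rightarrow> 'a pair_pre_digraph \<Rightarrow> ('a \<Rightarrow> nat) \<Rightarrow> 'a \<Rightarrow> bool" where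
  "defended k G f v \<longleftrightarrow> k \<le> f v \<or> (\<exists>U \<subseteq> open_nbhd G v. k \<le> (\<Sum>u\<in>U. f u - 1))"

lemma defended_self: "k \<le> f v \<Longrightarrow> defended k G f v"
  by (simp add: defended_def)

lemma defended_neighbour:
  assumes "u \<in> open_nbhd G v" "f u = k + 1"
  shows "defended k G f v"
  unfolding defended_def using assms by (intro disjI2 exI[of _ "{u}"]) simp

text \<open>The net contributions add up to \<open>2 * (k - 1)\<close>, and \<open>2 \<le> k\<close>
  makes this at least \<open>k\<close>.\<close>

lemma defended_two_neighbours:
  assumes "u \<in> open_nbhd G v" "w \<in> open_nbhd G v" "u \<noteq> w" "f u = k" "f w = k" "2 \<le> k"
  shows "defended k G f v"
  unfolding defended_def using assms by (intro disjI2 exI[of _ "{u, w}"]) simp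

text \<open>Enlarging \<open>U\<close> to the whole neighbourhood only increases the net sum; adding
  1 back for each active neighbour turns it into the sum of labels. The label of \<open>v\<close>
  itself is discarded, so the criterion is only sufficient.\<close>

lemma roman_dominatingI:
  assumes G: "pair_graph G"
    and le: "\<And>v. v \<in> pverts G \<Longrightarrow> f v \<le> k + 1"
    and df: "\<And>v. v \<in> pverts G \<Longrightarrow> defended k G f v"
  shows "roman_dominating k G f"
  unfolding roman_dominating_def
proof (intro conjI ballI impI)
  fix v assume v: "v \<in> pverts G" and lt: "f v < k"
  interpret pair_graph G by fact
  obtain U where U: "U \<subseteq> open_nbhd G v" "k \<le> (\<Sum>u\<in>U. f u - 1)"
    using df[OF v] lt by (auto simp: defended_def)
  have "open_nbhd G v \<subseteq> pverts G"
    by (auto simp: open_nbhd_def dest: wellformed')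
  then have fin: "finite (open_nbhd G v)"
    using pair_finite_verts by (rule finite_subset)
  let ?A = "active_nbhd G f v"
  have "(\<Sum>u\<in>U. f u - 1) \<le> (\<Sum>u\<in>open_nbhd G v. f u - 1)"
    using fin U(1) by (intro sum_mono2) auto
  also have "\<dots> = (\<Sum>u\<in>?A. f u - 1)"
    using fin by (intro sum.mono_neutral_right) (auto simp: active_nbhd_def)
  finally have "k + card ?A \<le> (\<Sum>u\<in>?A. f u - 1) + (\<Sum>u\<in>?A. 1)"
    using U(2) by simp
  also have "\<dots> = (\<Sum>u\<in>?A. f u)"
    unfolding sum.distrib[symmetric] by (intro sum.cong) (auto simp: active_nbhd_def)
  also have "\<dots> \<le> sum f (closed_nbhd G v)"
    using fin by (intro sum_mono2) (auto simp: active_nbhd_def closed_nbhd_def)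
  finally show "k + card ?A \<le> sum f (closed_nbhd G v)" .
qed (use le in auto)

section \<open>Adjacency in the cylinder\<close>

abbreviation cylinder :: "nat \<Rightarrow> nat \<Rightarrow> (nat \<times> nat) pair_pre_digraph" where
  "cylinder m n \<equiv> cycle_graph m \<box> path_graph n"

lemma cylinder_nbhd_cycle:
  assumes "j < n"
  shows "Suc i < m \<Longrightarrow> (Suc i, j) \<in> open_nbhd (cylinder m n) (i, j)"
    and "Suc i < m \<Longrightarrow> (i, j) \<in> open_nbhd (cylinder m n) (Suc i, j)"
    and "Suc i = m \<Longrightarrow> (0, j) \<in> open_nbhd (cylinder m n) (i, j)"
    and "Suc i = m \<Longrightarrow> (i, j) \<in> open_nbhd (cylinder m n) (0, j)"
proof -
  \<comment> \<open>With \<open>m = Suc i\<close>, these divisibilities say that rows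
    \<open>i\<close> and \<open>0\<close> differ by -1 and 1 modulo \<open>m\<close>.\<close>
  have wrap: "1 + int i dvd int i + 1" "1 + int i dvd - int i - 1"
    by (auto simp: dvd_def intro: exI[of _ 1] exI[of _ "- 1"])
  show "Suc i < m \<Longrightarrow> (Suc i, j) \<in> open_nbhd (cylinder m n) (i, j)"
    and "Suc i < m \<Longrightarrow> (i, j) \<in> open_nbhd (cylinder m n) (Suc i, j)"
    and "Suc i = m \<Longrightarrow> (0, j) \<in> open_nbhd (cylinder m n) (i, j)"
    and "Suc i = m \<Longrightarrow> (i, j) \<in> open_nbhd (cylinder m n) (0, j)"
    using assms wrap by (auto simp: open_nbhd_def parcs_cycle_path cong_iff_dvd_diff)
qed

lemma cylinder_nbhd_path:
  assumes "i < m" "Suc j < n"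
  shows "(i, Suc j) \<in> open_nbhd (cylinder m n) (i, j)"
    and "(i, j) \<in> open_nbhd (cylinder m n) (i, Suc j)"
  using assms by (auto simp: open_nbhd_def parcs_cycle_path)

text \<open>The server lies, in this order, in the next row, the previous row, the next column, the
  previous column, or across the wrap-around edge in either direction. Later proofs select the
  direction by number.\<close>

lemma defended_cylinder:
  assumes "j < n"
  shows "Suc i < m \<Longrightarrow> f (Suc i, j) = k + 1 \<Longrightarrow> defended k (cylinder m n) f (i, j)"
    and "i < m \<Longrightarrow> 0 < i \<Longrightarrow> f (i - 1, j) = k + 1 \<Longrightarrow> defended k (cylinder m n) f (i, j)"
    and "i < m \<Longrightarrow> Suc j < n \<Longrightarrow> f (i, Suc j) = k + 1 \<Longrightarrow> defended k (cylinder m n) f (i, j)"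
    and "i < m \<Longrightarrow> 0 < j \<Longrightarrow> f (i, j - 1) = k + 1 \<Longrightarrow> defended k (cylinder m n) f (i, j)"
    and "Suc i = m \<Longrightarrow> f (0, j) = k + 1 \<Longrightarrow> defended k (cylinder m n) f (i, j)"
    and "Suc i = m \<Longrightarrow> f (i, j) = k + 1 \<Longrightarrow> defended k (cylinder m n) f (0, j)"
  using assms cylinder_nbhd_cycle[of j n i m] cylinder_nbhd_cycle[of j n "i - 1" m]
    cylinder_nbhd_path[of i m j n] cylinder_nbhd_path[of i m "j - 1" n]
  by (auto intro: defended_neighbour)

lemma roman_domination_number_cylinder_le:
  assumes "m \<ge> 2"
    and "\<And>i j. i < m \<Longrightarrow> j < n \<Longrightarrow> f (i, j) \<le> k + 1"
    and "\<And>i j. i < m \<Longrightarrow> j < n \<Longrightarrow> defended k (cylinder m n) f (i, j)"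
  shows "roman_domination_number k (cylinder m n) \<le> (\<Sum>j<n. \<Sum>i<m. f (i, j))"
proof -
  have "roman_dominating k (cylinder m n) f"
    using assms pverts_cycle_path
    by (intro roman_dominatingI pair_graph_cartesian_product pair_graph_cycle_graph
        pair_graph_path_graph) auto
  then have "roman_domination_number k (cylinder m n) \<le> sum f (pverts (cylinder m n))"
    by (rule roman_domination_number_le)
  also have "pverts (cylinder m n) = {..<m} \<times> {..<n}"
    by (simp add: cartesian_product_def cycle_graph_def path_graph_def)
  also have "sum f ({..<m} \<times> {..<n}) = (\<Sum>j<n. \<Sum>i<m. f (i, j))"
    by (simp add: sum.cartesian_product' sum.swap[of _ "{..<m}"])
  finally show ?thesis .
qed

section \<open>Residues modulo 5 and sums of periodic functions\<close>

lemma lessThan_5: "{..<5::nat} = {0, 1, 2, 3, 4}"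
  by auto

lemma mod_5_cases:
  fixes a :: nat
  obtains "a mod 5 = 0" | "a mod 5 = 1" | "a mod 5 = 2" | "a mod 5 = 3" | "a mod 5 = 4"
  by fastforce

lemma mod_5_double: "2 * a mod 5 = 2 * (a mod 5) mod (5 :: nat)"
  by (simp only: mod_mult_right_eq)

lemma mod_5_pred:
  fixes a :: nat
  assumes "a mod 5 = Suc c"
  shows "(a - 1) mod 5 = c" "0 < a"
  using assms by (cases a; auto simp: mod_Suc split: if_splits)+

text \<open>Five consecutive integers meet every residue once, so each added block of five
  contributes the same full-period sum whatever the offset \<open>a\<close>.\<close>

lemma sum_mod_5:
  fixes h :: "nat \<Rightarrow> 'a::comm_semiring_1"
  shows "(\<Sum>i<5 * q + c. h ((i + a) mod 5)) = of_nat q * sum h {..<5} + (\<Sum>i<c. h ((i + a) mod 5))"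
proof (induction q)
  case (Suc q)
  have period: "h (b mod 5) + h (Suc b mod 5) + h (Suc (Suc b) mod 5) + h (Suc (Suc (Suc b)) mod 5)
      + h (Suc (Suc (Suc (Suc b))) mod 5) = sum h {..<5}" for b
    by (cases b rule: mod_5_cases) (simp_all add: lessThan_5 mod_Suc numeral_2_eq_2[symmetric] ac_simps)
  have shift: "5 * Suc q + c = Suc (Suc (Suc (Suc (Suc (5 * q + c)))))"
    by simp
  have "(\<Sum>i<5 * Suc q + c. h ((i + a) mod 5)) =
      (\<Sum>i<5 * q + c. h ((i + a) mod 5)) + sum h {..<5}"
    unfolding shift sum.lessThan_Suc period[of "5 * q + c + a", symmetric] add_Suc
    by (simp only: ac_simps)
  then show ?case
    unfolding Suc.IH by (simp add: algebra_simps)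
qed simp

section \<open>The perfect code on \<open>5 * t\<close> rows, followed by inserted rows\<close>

text \<open>In the infinite grid, residue 1 is served from the column to its left and residue 2 from
  the column to its right. In the first and last column respectively that server is missing, hence
  the label \<open>k\<close>.\<close>

definition code_label :: "nat \<Rightarrow> nat \<Rightarrow> nat \<Rightarrow> nat \<Rightarrow> nat" where
  "code_label k n i j =
     (let c = (i + 2 * j) mod 5
      in if c = 4 then k + 1 else if c = 1 \<and> j = 0 \<or> c = 2 \<and> Suc j = n then k else 0)"

text \<open>The inserted rows, which \<open>g\<close> counts from 0, lie between code row
  \<open>5 * t - 1\<close> and, through the wrap-around, code row \<open>0\<close>.\<close>

definition stacked_label ::
  "nat \<Rightarrow> nat \<Rightarrow> nat \<Rightarrow> (nat \<Rightarrow> nat \<Rightarrow> nat) \<Rightarrow> nat \<times> nat \<Rightarrow> nat" where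
  "stacked_label k n t g = (\<lambda>(i, j). if i < 5 * t then code_label k n i j else g (i - 5 * t) j)"

lemma stacked_label_code:
  "i < 5 * t \<Longrightarrow> (i + 2 * j) mod 5 = 4 \<Longrightarrow> stacked_label k n t g (i, j) = k + 1"
  by (simp add: stacked_label_def code_label_def)

lemma stacked_label_inserted [simp]: "stacked_label k n t g (5 * t + r, j) = g r j"
  by (simp add: stacked_label_def)

lemma stacked_label_le:
  assumes "i < 5 * t + e" and "\<And>r. r < e \<Longrightarrow> g r j \<le> k + 1"
  shows "stacked_label k n t g (i, j) \<le> k + 1"
proof (cases "i < 5 * t")
  case False
  then show ?thesis
    using assms by (auto simp: stacked_label_def)
qed (auto simp: stacked_label_def code_label_def Let_def)

text \<open>In row \<open>0\<close> the code condition reads \<open>2 * j\<close> congruent to 4,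
  that is, \<open>j\<close> congruent to 2. In the last code row it becomes \<open>j\<close>
  congruent to 0.\<close>

lemma stacked_label_first_row:
  assumes "0 < t" "j mod 5 = 2"
  shows "stacked_label k n t g (0, j) = k + 1"
  using assms by (intro stacked_label_code) (simp_all add: mod_5_double[of j])

lemma stacked_label_last_row:
  assumes "0 < t" "j mod 5 = 0"
  shows "stacked_label k n t g (5 * t - 1, j) = k + 1"
proof (rule stacked_label_code)
  obtain t' j' where "t = Suc t'" "j = 5 * j'"
    using assms gr0_conv_Suc by blast
  then have "5 * t - 1 + 2 * j = 4 + (t' + 2 * j') * 5"
    by simp
  then show "(5 * t - 1 + 2 * j) mod 5 = 4"
    by (simp only: mod_mult_self1) simp
qed (use assms in simp)

lemma defended_code_row:
  assumes m: "m = 5 * t + e" and i: "i < 5 * t" and j: "j < n"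
    and above: "0 < e \<Longrightarrow> j mod 5 = 2 \<Longrightarrow> g 0 j = k + 1"
    and below: "0 < e \<Longrightarrow> j mod 5 = 0 \<Longrightarrow>
      defended k (cylinder m n) (stacked_label k n t g) (0, j)"
  shows "defended k (cylinder m n) (stacked_label k n t g) (i, j)"
proof (cases "i + 2 * j" rule: mod_5_cases)
  case 1
  show ?thesis
  proof (cases i)
    case 0
    then have j0: "j mod 5 = 0"
      using 1 by (cases j rule: mod_5_cases) (simp_all add: mod_5_double[of j])
    show ?thesis
    proof (cases "0 < e")
      case False
      then have wrap: "Suc (5 * t - 1) = m"
        using i m by (cases t) auto
      show ?thesis
        unfolding 0 using i j0
        by (intro defended_cylinder(6)[OF j wrap] stacked_label_last_row) auto
    qed (use below j0 0 in auto)
  next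
    case (Suc i')
    then have "(i - 1 + 2 * j) mod 5 = 4"
      using 1 by (simp add: mod_Suc split: if_splits)
    then show ?thesis
      using m i j Suc by (intro defended_cylinder(2) stacked_label_code) auto
  qed
next
  case 2
  show ?thesis
  proof (cases j)
    case 0
    then show ?thesis
      using i 2 by (intro defended_self) (auto simp: stacked_label_def code_label_def)
  next
    case (Suc j')
    then have "(i + 2 * (j - 1)) mod 5 = 4"
      using 2 by (simp add: mod_Suc split: if_splits)
    then show ?thesis
      using m i j Suc by (intro defended_cylinder(4) stacked_label_code) auto
  qed
next
  case 3
  show ?thesis
  proof (cases "Suc j = n")
    case True
    then show ?thesis
      using i 3 by (intro defended_self) (auto simp: stacked_label_def code_label_def)
  next
    case False
    moreover have "(i + 2 * Suc j) mod 5 = 4"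
      using 3 by (simp add: mod_Suc split: if_splits)
    ultimately show ?thesis
      using m i j by (intro defended_cylinder(3) stacked_label_code) auto
  qed
next
  case 4
  show ?thesis
  proof (cases "Suc i < 5 * t")
    case True
    moreover have "(Suc i + 2 * j) mod 5 = 4"
      using 4 by (simp add: mod_Suc split: if_splits)
    ultimately show ?thesis
      using m j by (intro defended_cylinder(1) stacked_label_code) auto
  next
    case False
    then have last: "Suc i = 5 * t"
      using i by simp
    then have "Suc i + 2 * j = 2 * j + 5 * t"
      by simp
    moreover have "(Suc i + 2 * j) mod 5 = 4"
      using 4 by (simp add: mod_Suc)
    ultimately have "2 * j mod 5 = 4"
      by simp
    then have j2: "j mod 5 = 2"
      by (cases j rule: mod_5_cases) (simp_all add: mod_5_double[of j])
    show ?thesis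
    proof (cases "0 < e")
      case True
      then show ?thesis
        using m j last above[OF True j2] stacked_label_inserted[of k n t g 0 j]
        by (intro defended_cylinder(1)) auto
    next
      case False
      then show ?thesis
        using m i j last j2 by (intro defended_cylinder(5) stacked_label_first_row) auto
    qed
  qed
next
  case 5
  then show ?thesis
    using i by (intro defended_self) (simp add: stacked_label_code)
qed

text \<open>The shift \<open>2 * j\<close> does not matter over whole periods: each residue occurs
  \<open>t\<close> times.\<close>

lemma sum_code_label:
  "(\<Sum>i<5 * t. code_label k n i j) =
    t * (k + 1 + (if j = 0 then k else 0) + (if Suc j = n then k else 0))"
proof -
  define h where "h c = (if c = 4 then k + 1 else if c = 1 \<and> j = 0 \<or> c = 2 \<and> Suc j = n
    then k else 0)" for c :: nat
  have "(\<Sum>i<5 * t. code_label k n i j) = (\<Sum>i<5 * t + 0. h ((i + 2 * j) mod 5))"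
    by (simp add: code_label_def h_def Let_def)
  also have "\<dots> = t * sum h {..<5}"
    unfolding sum_mod_5 by simp
  also have "sum h {..<5} = k + 1 + (if j = 0 then k else 0) + (if Suc j = n then k else 0)"
    by (simp add: lessThan_5 h_def)
  finally show ?thesis .
qed

lemma sum_stacked_label:
  assumes "0 < n"
  shows "(\<Sum>j<n. \<Sum>i<5 * t + e. stacked_label k n t g (i, j)) =
    t * (n * (k + 1) + 2 * k) + (\<Sum>j<n. \<Sum>r<e. g r j)"
proof -
  have split: "(\<Sum>i<5 * t + e. stacked_label k n t g (i, j)) =
      (\<Sum>i<5 * t. code_label k n i j) + (\<Sum>r<e. g r j)" for j
  proof (induction e)
    case (Suc e)
    then show ?case
      by simp
  qed (simp add: stacked_label_def)
  obtain N where N: "n = Suc N"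
    using assms gr0_conv_Suc by auto
  have end_sums: "(\<Sum>j<n. if j = 0 then k else 0) = k" "(\<Sum>j<n. if Suc j = n then k else 0) = k"
    unfolding N by (simp_all add: sum.delta)
  have "(\<Sum>j<n. (k + 1) + (if j = 0 then k else 0) + (if Suc j = n then k else 0)) =
      n * (k + 1) + 2 * k"
    using end_sums by (simp add: sum.distrib del: add_Suc_right add_Suc)
  then show ?thesis
    unfolding split sum_code_label sum.distrib sum_distrib_left[symmetric] by simp
qed

text \<open>This reduces a residue class to the choice of \<open>g\<close>. If \<open>t = 0\<close>,
  row \<open>0\<close> is itself an inserted row and is handled by \<open>inserted\<close>.\<close>

lemma roman_domination_number_stacked_le:
  assumes m: "m = 5 * t + e" "2 \<le> m" and n: "0 < n"
    and le: "\<And>r j. r < e \<Longrightarrow> j < n \<Longrightarrow> g r j \<le> k + 1"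
    and above: "\<And>j. 0 < e \<Longrightarrow> j < n \<Longrightarrow> j mod 5 = 2 \<Longrightarrow> g 0 j = k + 1"
    and below: "\<And>j. 0 < t \<Longrightarrow> 0 < e \<Longrightarrow> j < n \<Longrightarrow> j mod 5 = 0 \<Longrightarrow>
      defended k (cylinder m n) (stacked_label k n t g) (0, j)"
    and inserted: "\<And>r j. r < e \<Longrightarrow> j < n \<Longrightarrow>
      defended k (cylinder m n) (stacked_label k n t g) (5 * t + r, j)"
  shows "roman_domination_number k (cylinder m n) \<le>
    t * (n * (k + 1) + 2 * k) + (\<Sum>j<n. \<Sum>r<e. g r j)"
proof -
  have "roman_domination_number k (cylinder m n) \<le>
      (\<Sum>j<n. \<Sum>i<m. stacked_label k n t g (i, j))"
  proof (rule roman_domination_number_cylinder_le[OF m(2)])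
    fix i j assume i: "i < m" and j: "j < n"
    show "stacked_label k n t g (i, j) \<le> k + 1"
      using i j le m by (intro stacked_label_le[of i t e]) auto
    show "defended k (cylinder m n) (stacked_label k n t g) (i, j)"
    proof (cases "i < 5 * t")
      case True
      then have "0 < t"
        by (cases t) auto
      show ?thesis
        by (rule defended_code_row[OF m(1) True j]) (fact above[OF _ j] below[OF \<open>0 < t\<close> _ j])+
    next
      case False
      then obtain r where r: "i = 5 * t + r" "r < e"
        using i m(1) by (intro that[of "i - 5 * t"]) auto
      then show ?thesis
        using inserted[OF r(2) j] by simp
    qed
  qed
  then show ?thesis
    unfolding m(1) sum_stacked_label[OF n] .
qed

section \<open>Residues 1, 2, 3 and 0 of \<open>m\<close>: choosing the inserted rows\<close>

text \<open>
  The inserted row has label \<open>k\<close> rather than \<open>k + 1\<close> at \<open>j = 0\<close>: the bound leaves no room for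
  \<open>k + 1\<close> if \<open>n = 7\<close>. The vertex \<open>(0, 0)\<close> is then the only one relying on two neighbours of label \<open>k\<close>.
\<close>

lemma cylinder_bound_1:
  fixes k n m t q s :: nat
  assumes k: "2 \<le> k" and n: "4 \<le> n" "n = 5 * q + (2 + s)" "s < 5"
    and m: "m = 5 * t + 1" and t: "0 < t"
  shows "roman_domination_number k (cylinder m n) + (4 * k + 1) + 2 * (k + 2) * q \<le>
    (t + 1) * (n * (k + 1) + 2 * k)"
proof -
  \<comment> \<open>Residue 2 serves the last code row and residue 0 serves row \<open>0\<close>.
    Residues 1, 3 and 4 are covered along the inserted row, except residue 4 in the last column,
    whose right neighbour is missing.\<close>
  define g where "g r j = (if j = 0 then k else if j mod 5 = 0 \<or> j mod 5 = 2 then k + 1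
    else if j mod 5 = 4 \<and> Suc j = n then k else 0)" for r j :: nat
  let ?f = "stacked_label k n t g"
  have f [simp]: "?f (5 * t, j) = g 0 j" for j
    using stacked_label_inserted[of k n t g 0 j] by simp
  have "roman_domination_number k (cylinder m n) \<le>
      t * (n * (k + 1) + 2 * k) + (\<Sum>j<n. \<Sum>r<1. g r j)"
  proof (rule roman_domination_number_stacked_le[OF m])
    fix j assume j: "j < n" "j mod 5 = 0"
    show "defended k (cylinder m n) ?f (0, j)"
    proof (cases "j = 0")
      case True
      \<comment> \<open>\<open>(1, 0)\<close> has label \<open>k\<close> as a boundary vertex of
        residue 1, and \<open>(5 * t, 0)\<close> has it by the choice of \<open>g\<close>.\<close>
      have "(Suc 0, 0) \<in> open_nbhd (cylinder m n) (0, 0)"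
        "(5 * t, 0) \<in> open_nbhd (cylinder m n) (0, 0)"
        using m t n cylinder_nbhd_cycle(1)[of 0 n 0 m] cylinder_nbhd_cycle(4)[of 0 n "5 * t" m] by auto
      moreover have "?f (Suc 0, 0) = k"
        using t by (simp add: stacked_label_def code_label_def)
      ultimately show ?thesis
        unfolding True using k
        by (intro defended_two_neighbours[of "(Suc 0, 0)" _ _ "(5 * t, 0)"]) (auto simp: g_def)
    next
      case False
      then show ?thesis
        using j m by (intro defended_cylinder(6)[of _ _ "5 * t"]) (auto simp: g_def)
    qed
  next
    fix r j :: nat assume "r < 1" and j: "j < n"
    then have r: "r = 0"
      by simp
    have i: "5 * t + r < m"
      using m r by simp
    show "defended k (cylinder m n) ?f (5 * t + r, j)"
    proof (cases j rule: mod_5_cases)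
      case 1
      then show ?thesis
        using r by (intro defended_self) (auto simp: g_def)
    next
      case 2
      show ?thesis
      proof (cases "Suc j < n")
        case True
        then show ?thesis
          using 2 j i r by (intro defended_cylinder(3)) (auto simp: g_def mod_Suc)
      next
        case False
        \<comment> \<open>Since \<open>n \<ge> 4\<close>, the left neighbour is not the exceptional
          column \<open>0\<close> of label \<open>k\<close>.\<close>
        then have "j - 1 \<noteq> 0"
          using n by simp
        then show ?thesis
          using 2 j i r mod_5_pred[of j 0] by (intro defended_cylinder(4)) (auto simp: g_def)
      qed
    next
      case 3
      then show ?thesis
        using r by (intro defended_self) (auto simp: g_def)
    next
      case 4
      then have "(j - 1) mod 5 = 2" "0 < j"
        using mod_5_pred[of j 2] by auto
      then show ?thesis
        using j i r by (intro defended_cylinder(4)) (auto simp: g_def)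
    next
      case 5
      show ?thesis
      proof (cases "Suc j < n")
        case True
        then show ?thesis
          using 5 j i r by (intro defended_cylinder(3)) (auto simp: g_def mod_Suc)
      next
        case False
        then show ?thesis
          using 5 j r by (intro defended_self) (auto simp: g_def)
      qed
    qed
  qed (use m t n in \<open>auto simp: g_def\<close>)
  moreover have "(\<Sum>j<n. \<Sum>r<1. g r j) + (4 * k + 1) + 2 * (k + 2) * q \<le> n * (k + 1) + 2 * k"
  proof -
    define p where "p c = (if c = 0 \<or> c = 2 then k + 1 else 0)" for c :: nat
    have p5: "sum p {..<5} = 2 * k + 2"
      by (simp add: p_def lessThan_5)
    obtain N where N: "n = Suc N"
      using n by (cases n) auto
    \<comment> \<open>\<open>g\<close> differs from its periodic part \<open>p\<close> by a deficit
      of 1 in column \<open>0\<close> and a possible extra \<open>k\<close> in the last column. The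
      deficit is added on the left to avoid subtraction.\<close>
    have pt: "g 0 j + (if j = 0 then 1 else 0) =
        p (j mod 5) + (if j = N then if j mod 5 = 4 then k else 0 else 0)" for j
      using n by (auto simp: g_def p_def N)
    have "(\<Sum>j<n. g 0 j) + 1 = (\<Sum>j<n. g 0 j + (if j = 0 then 1 else 0))"
      using N by (simp add: sum.distrib)
    also have "\<dots> = (\<Sum>j<n. p (j mod 5)) + (if N mod 5 = 4 then k else 0)"
      unfolding pt sum.distrib by (simp add: N)
    also have "(\<Sum>j<n. p (j mod 5)) = q * (2 * k + 2) + (\<Sum>j<2 + s. p (j mod 5))"
      using sum_mod_5[of p 0 q "2 + s"] p5 by (simp add: n(2))
    finally have W: "(\<Sum>j<n. g 0 j) + 1 = q * (2 * k + 2) + (\<Sum>j<2 + s. p (j mod 5))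
      + (if N mod 5 = 4 then k else 0)" .
    have N': "N mod 5 = (1 + s) mod 5"
      using N n mod_mult_self4[of 5 q "1 + s"] by simp
    obtain k' where k': "k = k' + 2"
      using k le_Suc_ex by (metis add.commute)
    \<comment> \<open>For \<open>s = 0\<close> and \<open>s = 1\<close> the slack is
      \<open>(q - 1) * (k - 1)\<close>, so \<open>q = 0\<close> has to be excluded;
      \<open>n \<ge> 4\<close> does this.\<close>
    consider q' where "s = 0" "q = Suc q'" | q' where "s = 1" "q = Suc q'" | "s = 2" | "s = 3" | "s = 4"
      using n by (cases q) force+
    then show ?thesis
    proof cases
      case 1
      have "(\<Sum>j<2 + s. p (j mod 5)) = k + 1" "N mod 5 \<noteq> 4"
        by (simp_all add: 1 p_def lessThan_nat_numeral N')
      then show ?thesis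
        using W 1 n(2) by (simp add: k' algebra_simps)
    next
      case 2
      have "(\<Sum>j<2 + s. p (j mod 5)) = 2 * k + 2" "N mod 5 \<noteq> 4"
        by (simp_all add: 2 p_def lessThan_nat_numeral N')
      then show ?thesis
        using W 2 n(2) by (simp add: k' algebra_simps)
    next
      case 3
      have "(\<Sum>j<2 + s. p (j mod 5)) = 2 * k + 2" "N mod 5 \<noteq> 4"
        by (simp_all add: 3 p_def lessThan_nat_numeral N')
      then show ?thesis
        using W 3 n(2) by (simp add: k' algebra_simps)
    next
      case 4
      have "(\<Sum>j<2 + s. p (j mod 5)) = 2 * k + 2" "N mod 5 = 4"
        by (simp_all add: 4 p_def lessThan_nat_numeral N')
      then show ?thesis
        using W 4 n(2) by (simp add: k' algebra_simps)
    next
      case 5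
      have "(\<Sum>j<2 + s. p (j mod 5)) = 3 * k + 3" "N mod 5 \<noteq> 4"
        by (simp_all add: 5 p_def lessThan_nat_numeral N')
      then show ?thesis
        using W 5 n(2) by (simp add: k' algebra_simps)
    qed
  qed
  ultimately show ?thesis
    by simp
qed

text \<open>Three labels \<open>k + 1\<close> per five columns suffice: the first inserted row has
  them at residues 2 and 3, the second at residue 0. The adjacent code rows cover residue 0 of the
  first row and residue 2 of the second. Residue 1 of the first row and residue 4 of the second rely
  on the next column, hence their label \<open>k\<close> in the last one.\<close>

lemma cylinder_bound_2:
  fixes k n m t q s :: nat
  assumes k: "2 \<le> k" and n: "4 \<le> n" "n = 5 * q + (2 + s)" "s < 5"
    and m: "m = 5 * t + 2" and t: "0 < t"
  shows "roman_domination_number k (cylinder m n) + 3 * k + (k + 3) * q \<le>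
    (t + 1) * (n * (k + 1) + 2 * k)"
proof -
  define g where "g r j = (if r = 0
      then if j mod 5 = 2 \<or> j mod 5 = 3 then k + 1 else if j mod 5 = 1 \<and> Suc j = n then k else 0
      else if j mod 5 = 0 then k + 1 else if j mod 5 = 4 \<and> Suc j = n then k else 0)" for r j :: nat
  let ?f = "stacked_label k n t g"
  have f [simp]: "?f (5 * t, j) = g 0 j" "?f (Suc (5 * t), j) = g 1 j" for j
    using stacked_label_inserted[of k n t g 0 j] stacked_label_inserted[of k n t g 1 j] by simp_all
  have "roman_domination_number k (cylinder m n) \<le>
      t * (n * (k + 1) + 2 * k) + (\<Sum>j<n. \<Sum>r<2. g r j)"
  proof (rule roman_domination_number_stacked_le[OF m])
    fix j assume j: "j < n" "j mod 5 = 0"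
    then show "defended k (cylinder m n) ?f (0, j)"
      using m by (intro defended_cylinder(6)[of _ _ "Suc (5 * t)"]) (auto simp: g_def)
  next
    fix r j :: nat assume "r < 2" and j: "j < n"
    then consider (A) "5 * t + r = 5 * t" | (B) "5 * t + r = Suc (5 * t)"
      by force
    then show "defended k (cylinder m n) ?f (5 * t + r, j)"
    proof cases
      case A
      show ?thesis
        unfolding A
      proof (cases j rule: mod_5_cases)
        case 1
        show "defended k (cylinder m n) ?f (5 * t, j)"
          using 1 j m t by (intro defended_cylinder(2) stacked_label_last_row) auto
      next
        case 2
        show "defended k (cylinder m n) ?f (5 * t, j)"
        proof (cases "Suc j < n")
          case True
          then show ?thesis
            using 2 j m by (intro defended_cylinder(3)) (auto simp: g_def mod_Suc)
        next
          case False
          then show ?thesis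
            using 2 j by (intro defended_self) (auto simp: g_def)
        qed
      next
        case 5
        then show "defended k (cylinder m n) ?f (5 * t, j)"
          using j m mod_5_pred[of j 3] by (intro defended_cylinder(4)) (auto simp: g_def)
      qed (auto intro!: defended_self simp: g_def)
    next
      case B
      show ?thesis
        unfolding B
      proof (cases j rule: mod_5_cases)
        case 2
        then show "defended k (cylinder m n) ?f (Suc (5 * t), j)"
          using j m mod_5_pred[of j 0] by (intro defended_cylinder(4)) (auto simp: g_def)
      next
        case 3
        then show "defended k (cylinder m n) ?f (Suc (5 * t), j)"
          using j m t by (intro defended_cylinder(5) stacked_label_first_row) auto
      next
        case 4
        then show "defended k (cylinder m n) ?f (Suc (5 * t), j)"
          using j m by (intro defended_cylinder(2)) (auto simp: g_def)
      next
        case 5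
        show "defended k (cylinder m n) ?f (Suc (5 * t), j)"
        proof (cases "Suc j < n")
          case True
          then show ?thesis
            using 5 j m by (intro defended_cylinder(3)) (auto simp: g_def mod_Suc)
        next
          case False
          then show ?thesis
            using 5 j by (intro defended_self) (auto simp: g_def)
        qed
      qed (auto intro!: defended_self simp: g_def)
    qed
  qed (use m t n in \<open>auto simp: g_def\<close>)
  moreover have "(\<Sum>j<n. \<Sum>r<2. g r j) + 3 * k + (k + 3) * q \<le> n * (k + 1) + 2 * k"
  proof -
    define p where "p c = (if c = 0 \<or> c = 2 \<or> c = 3 then k + 1 else 0)" for c :: nat
    have p5: "sum p {..<5} = 3 * k + 3"
      by (simp add: p_def lessThan_5)
    obtain N where N: "n = Suc N"
      using n by (cases n) auto
    have pt: "(\<Sum>r<2. g r j) =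
        p (j mod 5) + (if j = N then if j mod 5 = 1 \<or> j mod 5 = 4 then k else 0 else 0)" for j
      by (auto simp: g_def p_def N numeral_2_eq_2)
    have "(\<Sum>j<n. \<Sum>r<2. g r j) =
        (\<Sum>j<n. p (j mod 5)) + (if N mod 5 = 1 \<or> N mod 5 = 4 then k else 0)"
      unfolding pt sum.distrib by (simp add: N)
    also have "(\<Sum>j<n. p (j mod 5)) = q * (3 * k + 3) + (\<Sum>j<2 + s. p (j mod 5))"
      using sum_mod_5[of p 0 q "2 + s"] p5 by (simp add: n(2))
    finally have W: "(\<Sum>j<n. \<Sum>r<2. g r j) = q * (3 * k + 3) + (\<Sum>j<2 + s. p (j mod 5))
      + (if N mod 5 = 1 \<or> N mod 5 = 4 then k else 0)" .
    have N': "N mod 5 = (1 + s) mod 5"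
      using N n mod_mult_self4[of 5 q "1 + s"] by simp
    obtain k' where k': "k = k' + 2"
      using k le_Suc_ex by (metis add.commute)
    \<comment> \<open>Only \<open>s = 0\<close> needs \<open>q\<close> positive: its slack is again
      \<open>(q - 1) * (k - 1)\<close>.\<close>
    consider q' where "s = 0" "q = Suc q'" | "s = 1" | "s = 2" | "s = 3" | "s = 4"
      using n by (cases q) force+
    then show ?thesis
    proof cases
      case 1
      have "(\<Sum>j<2 + s. p (j mod 5)) = k + 1" "N mod 5 = 1"
        by (simp_all add: 1 p_def lessThan_nat_numeral N')
      then show ?thesis
        using W 1 n(2) by (simp add: k' algebra_simps)
    next
      case 2
      have "(\<Sum>j<2 + s. p (j mod 5)) = 2 * k + 2" "N mod 5 = 2"
        by (simp_all add: 2 p_def lessThan_nat_numeral N')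
      then show ?thesis
        using W 2 n(2) by (simp add: k' algebra_simps)
    next
      case 3
      have "(\<Sum>j<2 + s. p (j mod 5)) = 3 * k + 3" "N mod 5 = 3"
        by (simp_all add: 3 p_def lessThan_nat_numeral N')
      then show ?thesis
        using W 3 n(2) by (simp add: k' algebra_simps)
    next
      case 4
      have "(\<Sum>j<2 + s. p (j mod 5)) = 3 * k + 3" "N mod 5 = 4"
        by (simp_all add: 4 p_def lessThan_nat_numeral N')
      then show ?thesis
        using W 4 n(2) by (simp add: k' algebra_simps)
    next
      case 5
      have "(\<Sum>j<2 + s. p (j mod 5)) = 4 * k + 4" "N mod 5 = 0"
        by (simp_all add: 5 p_def lessThan_nat_numeral N')
      then show ?thesis
        using W 5 n(2) by (simp add: k' algebra_simps)
    qed
  qed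
  ultimately show ?thesis
    by simp
qed

text \<open>Each column carries exactly one label on its three inserted vertices: \<open>k\<close>
  at residues 1 and 4, otherwise \<open>k + 1\<close>. In a last column of residue 1 or 4 the middle
  vertex gets \<open>k + 1\<close> and serves the other two. The saving is thus 2 per full
  period.\<close>

lemma cylinder_bound_3:
  fixes k n m t q s :: nat
  assumes n: "0 < n" "n = 5 * q + (2 + s)" "s < 5" and m: "m = 5 * t + 3"
  shows "roman_domination_number k (cylinder m n) + 2 * k + 2 * q \<le>
    (t + 1) * (n * (k + 1) + 2 * k)"
proof -
  define g where "g r j = (if r = 0
      then if j mod 5 = 2 then k + 1 else if j mod 5 = 4 \<and> Suc j \<noteq> n then k else 0
      else if r = 1
      then if j mod 5 = 3 \<or> Suc j = n \<and> (j mod 5 = 1 \<or> j mod 5 = 4) then k + 1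
        else if j mod 5 = 1 then k else 0
      else if j mod 5 = 0 then k + 1 else 0)" for r j :: nat
  let ?f = "stacked_label k n t g"
  have f [simp]: "?f (5 * t, j) = g 0 j" "?f (Suc (5 * t), j) = g 1 j"
    "?f (Suc (Suc (5 * t)), j) = g 2 j" for j
    using stacked_label_inserted[of k n t g 0 j] stacked_label_inserted[of k n t g 1 j]
      stacked_label_inserted[of k n t g 2 j] by simp_all
  have "roman_domination_number k (cylinder m n) \<le>
      t * (n * (k + 1) + 2 * k) + (\<Sum>j<n. \<Sum>r<3. g r j)"
  proof (rule roman_domination_number_stacked_le[OF m])
    fix j assume j: "j < n" "j mod 5 = 0"
    then show "defended k (cylinder m n) ?f (0, j)"
      using m by (intro defended_cylinder(6)[of _ _ "Suc (Suc (5 * t))"]) (auto simp: g_def)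
  next
    fix r j :: nat assume "r < 3" and j: "j < n"
    then consider (A) "5 * t + r = 5 * t" | (B) "5 * t + r = Suc (5 * t)"
      | (C) "5 * t + r = Suc (Suc (5 * t))"
      by force
    then show "defended k (cylinder m n) ?f (5 * t + r, j)"
    proof cases
      case A
      show ?thesis
        unfolding A
      proof (cases j rule: mod_5_cases)
        case 1
        show "defended k (cylinder m n) ?f (5 * t, j)"
        proof (cases t)
          \<comment> \<open>For \<open>m = 3\<close> there are no code rows; the third inserted row
            is then adjacent to the first and is also labelled \<open>k + 1\<close> at residue
            0.\<close>
          case 0
          then show ?thesis
            using 1 j m f(3)[of j]
            by (auto intro!: defended_cylinder(6)[of _ _ "Suc (Suc (5 * t))"] simp: g_def)
        next
          case (Suc t')
          then show ?thesis
            using 1 j m by (intro defended_cylinder(2) stacked_label_last_row) auto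
        qed
      next
        case 2
        show "defended k (cylinder m n) ?f (5 * t, j)"
        proof (cases "Suc j < n")
          case True
          then show ?thesis
            using 2 j m by (intro defended_cylinder(3)) (auto simp: g_def mod_Suc)
        next
          case False
          then show ?thesis
            using 2 j m by (intro defended_cylinder(1)) (auto simp: g_def)
        qed
      next
        case 4
        then show "defended k (cylinder m n) ?f (5 * t, j)"
          using j m mod_5_pred[of j 2] by (intro defended_cylinder(4)) (auto simp: g_def)
      next
        case 5
        show "defended k (cylinder m n) ?f (5 * t, j)"
        proof (cases "Suc j < n")
          case True
          then show ?thesis
            using 5 j by (intro defended_self) (auto simp: g_def)
        next
          case False
          then show ?thesis
            using 5 j m by (intro defended_cylinder(1)) (auto simp: g_def)
        qed
      qed (auto intro!: defended_self simp: g_def)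
    next
      case B
      show ?thesis
        unfolding B
      proof (cases j rule: mod_5_cases)
        case 1
        then show "defended k (cylinder m n) ?f (Suc (5 * t), j)"
          using j m by (intro defended_cylinder(1)) (auto simp: g_def)
      next
        case 3
        then show "defended k (cylinder m n) ?f (Suc (5 * t), j)"
          using j m by (intro defended_cylinder(2)) (auto simp: g_def)
      next
        case 5
        then show "defended k (cylinder m n) ?f (Suc (5 * t), j)"
          using j m mod_5_pred[of j 3] by (intro defended_cylinder(4)) (auto simp: g_def)
      qed (auto intro!: defended_self simp: g_def)
    next
      case C
      show ?thesis
        unfolding C
      proof (cases j rule: mod_5_cases)
        case 2
        then show "defended k (cylinder m n) ?f (Suc (Suc (5 * t)), j)"
          using j m mod_5_pred[of j 0] by (intro defended_cylinder(4)) (auto simp: g_def)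
      next
        case 3
        have "?f (0, j) = k + 1"
        proof (cases t)
          case 0
          then show ?thesis
            using 3 f(1)[of j] by (simp add: g_def)
        qed (use 3 in \<open>simp add: stacked_label_first_row\<close>)
        then show "defended k (cylinder m n) ?f (Suc (Suc (5 * t)), j)"
          using j m by (intro defended_cylinder(5)) auto
      next
        case 4
        then show "defended k (cylinder m n) ?f (Suc (Suc (5 * t)), j)"
          using j m by (intro defended_cylinder(2)) (auto simp: g_def)
      next
        case 5
        show "defended k (cylinder m n) ?f (Suc (Suc (5 * t)), j)"
        proof (cases "Suc j < n")
          case True
          then show ?thesis
            using 5 j m by (intro defended_cylinder(3)) (auto simp: g_def mod_Suc)
        next
          case False
          then show ?thesis
            using 5 j m by (intro defended_cylinder(2)) (auto simp: g_def)
        qed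
      qed (auto intro!: defended_self simp: g_def)
    qed
  qed (use m n in \<open>auto simp: g_def\<close>)
  moreover have "(\<Sum>j<n. \<Sum>r<3. g r j) + 2 * k + 2 * q \<le> n * (k + 1) + 2 * k"
  proof -
    define p where "p c = (if c = 1 \<or> c = 4 then k else k + 1)" for c :: nat
    have p5: "sum p {..<5} = 5 * k + 3"
      by (simp add: p_def lessThan_5)
    have N: "n = Suc (5 * q + (1 + s))"
      using n by simp
    have col: "(\<Sum>r<3. g r j) = (if Suc j = n then k + 1 else p (j mod 5))" for j
      by (cases j rule: mod_5_cases) (auto simp: g_def p_def numeral_3_eq_3)
    have "(\<Sum>j<n. \<Sum>r<3. g r j) = (\<Sum>j<5 * q + (1 + s). p (j mod 5)) + (k + 1)"
      unfolding col by (simp add: N)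
    also have "(\<Sum>j<5 * q + (1 + s). p (j mod 5)) =
        q * (5 * k + 3) + (\<Sum>j<1 + s. p (j mod 5))"
      using sum_mod_5[of p 0 q "1 + s"] p5 by simp
    \<comment> \<open>No saving is claimed in the incomplete period: the full periods already give
      \<open>2 * q\<close>.\<close>
    also have "(\<Sum>j<1 + s. p (j mod 5)) \<le> (1 + s) * (k + 1)"
      using sum_bounded_above[of "{..<1 + s}" "\<lambda>j. p (j mod 5)" "k + 1"] by (simp add: p_def)
    finally show ?thesis
      by (simp add: n(2) algebra_simps)
  qed
  ultimately show ?thesis
    by simp
qed

lemma cylinder_bound_0:
  fixes k n m t :: nat
  assumes "0 < n" "m = 5 * t" "2 \<le> m"
  shows "roman_domination_number k (cylinder m n) \<le> t * (n * (k + 1) + 2 * k)"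
  using roman_domination_number_stacked_le[of m t 0 n "\<lambda>_ _. 0" k] assms by simp

section \<open>Residue 4 of \<open>m\<close>: the twisted code\<close>

text \<open>\<open>m - 2\<close> stands for \<open>-2\<close>, so this is \<open>(i - 2 j) mod m\<close> without truncated subtraction.\<close>

definition twisted_residue :: "nat \<Rightarrow> nat \<Rightarrow> nat \<Rightarrow> nat" where
  "twisted_residue m i j = (i + (m - 2) * j) mod m"

lemma twisted_residue_less: "0 < m \<Longrightarrow> twisted_residue m i j < m"
  by (simp add: twisted_residue_def)

lemma twisted_residue_Suc: "twisted_residue m (Suc i) j = Suc (twisted_residue m i j) mod m"
  by (simp add: twisted_residue_def mod_Suc_eq)

lemma twisted_residue_wrap: "twisted_residue m m j = twisted_residue m 0 j"
  by (simp add: twisted_residue_def)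

text \<open>A step to the right subtracts 2 modulo \<open>m\<close>; this orientation keeps the
  equation free of subtraction.\<close>

lemma twisted_residue_Suc_right:
  assumes "2 \<le> m"
  shows "twisted_residue m i j = (twisted_residue m i (Suc j) + 2) mod m"
proof -
  obtain m' where m': "m = m' + 2"
    using assms le_Suc_ex by (metis add.commute)
  have shift: "i + m' * Suc j + 2 = i + m' * j + (m' + 2)"
    by simp
  show ?thesis
    unfolding twisted_residue_def mod_add_left_eq m' add_diff_cancel_right' shift mod_add_self2 ..
qed

text \<open>A translation permutes the residues modulo \<open>m\<close>, so column sums may run over
  residues instead of rows.\<close>

lemma bij_betw_twisted_residue:
  assumes "0 < m"
  shows "bij_betw (\<lambda>i. twisted_residue m i j) {..<m} {..<m}"
proof -
  have "inj_on (\<lambda>i. twisted_residue m i j) {..<m}"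
  proof (rule inj_onI)
    fix i i' assume "i \<in> {..<m}" "i' \<in> {..<m}" "twisted_residue m i j = twisted_residue m i' j"
    then have "[i = i'] (mod m)" "i < m" "i' < m"
      by (simp_all add: twisted_residue_def flip: cong_def) (simp add: cong_add_rcancel_nat)
    then show "i = i'"
      by (simp add: cong_def)
  qed
  moreover have "(\<lambda>i. twisted_residue m i j) ` {..<m} \<subseteq> {..<m}"
    using assms by (auto simp: twisted_residue_less)
  ultimately show ?thesis
    by (simp add: bij_betw_def endo_inj_surj)
qed

text \<open>With \<open>d\<close> the twisted residue, \<open>d mod 5\<close> equal to 1, 2, 3, 4 is
  served from the previous row, next column, previous column and next row. In the gap of 4 before
  \<open>m\<close>, residue \<open>m - 2\<close> is served from the previous column too and
  \<open>m - 1\<close> from the next row, so neither needs a boundary label.\<close>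

lemma cylinder_bound_4:
  fixes k n m t :: nat
  assumes n: "2 \<le> n" and m: "m = 5 * t + 4"
  shows "roman_domination_number k (cylinder m n) + 2 * k \<le> (t + 1) * (n * (k + 1) + 2 * k)"
proof -
  let ?D = "twisted_residue m"
  define g where "g d j = (if d mod 5 = 0 then k + 1
    else if d mod 5 = 2 \<and> Suc j = n \<and> d + 2 \<noteq> m \<or> d mod 5 = 3 \<and> j = 0 \<and> d + 1 \<noteq> m then k
    else 0)" for d j :: nat
  define f where "f = (\<lambda>(i, j). g (?D i j) j)"
  have code: "f (i, j) = k + 1" if "?D i j = d" "d mod 5 = 0" for i j d
    using that by (simp add: f_def g_def)
  have col: "(\<Sum>d<m. g d j) = (t + 1) * (k + 1) + t * (if j = 0 then k else 0)
      + t * (if Suc j = n then k else 0)" for j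
  proof -
    define h where "h c = (if c = 0 then k + 1
      else if c = 2 \<and> Suc j = n \<or> c = 3 \<and> j = 0 then k else 0)" for c :: nat
    have h5: "sum h {..<5} = k + 1 + (if j = 0 then k else 0) + (if Suc j = n then k else 0)"
      by (simp add: h_def lessThan_5)
    \<comment> \<open>These two residues are the exceptions \<open>m - 2\<close> and
      \<open>m - 1\<close>; below them \<open>g\<close> is periodic in \<open>d\<close>.\<close>
    have top: "g (5 * t + 2) j = 0" "g (5 * t + 3) j = 0"
      using mod_mult_self4[of 5 t 2] mod_mult_self4[of 5 t 3] by (simp_all add: g_def m)
    have "(\<Sum>d<m. g d j) = (\<Sum>d<5 * t + 2. g d j) + g (5 * t + 2) j + g (5 * t + 3) j"
      unfolding m by (simp add: numeral_2_eq_2 numeral_3_eq_3 eval_nat_numeral)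
    also have "(\<Sum>d<5 * t + 2. g d j) = (\<Sum>d<5 * t + 2. h (d mod 5))"
      by (intro sum.cong) (auto simp: g_def h_def m)
    also have "\<dots> = t * sum h {..<5} + (k + 1)"
      using sum_mod_5[of h 0 t 2] by (simp add: h_def lessThan_nat_numeral)
    finally show ?thesis
      unfolding top h5 by (simp add: algebra_simps)
  qed
  have "roman_domination_number k (cylinder m n) \<le> (\<Sum>j<n. \<Sum>i<m. f (i, j))"
  proof (rule roman_domination_number_cylinder_le)
    fix i j assume i: "i < m" and j: "j < n"
    show "f (i, j) \<le> k + 1"
      by (simp add: f_def g_def)
    define d where "d = ?D i j"
    have fd: "f (i, j) = g d j"
      by (simp add: f_def d_def)
    have d: "d < m"
      using m by (simp add: d_def twisted_residue_less)
    have left: "?D i (j - 1) = (d + 2) mod m" if "0 < j"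
      using twisted_residue_Suc_right[of m i "j - 1"] that m by (simp add: d_def)
    have up: "defended k (cylinder m n) f (i, j)" if "Suc d mod m mod 5 = 0"
    proof (cases "Suc i < m")
      case True
      then show ?thesis
        using j that by (intro defended_cylinder(1) code) (auto simp: twisted_residue_Suc d_def)
    next
      case False
      then have "Suc i = m"
        using i by simp
      moreover from this have "?D 0 j = Suc d mod m"
        using twisted_residue_Suc[of m i j] by (simp add: twisted_residue_wrap d_def)
      ultimately show ?thesis
        using j that by (intro defended_cylinder(5) code) auto
    qed
    have down: "defended k (cylinder m n) f (i, j)" if "d mod 5 = 1"
    proof -
      \<comment> \<open>A wrap-around from \<open>e = m - 1\<close> would give \<open>d = 0\<close>,
        contrary to \<open>d mod 5 = 1\<close>.\<close>
      have pred: "e mod 5 = 0" if "e < m" "d = Suc e mod m" for e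
        using that \<open>d mod 5 = 1\<close> mod_5_pred[of d 0] by (cases "Suc e = m") auto
      show ?thesis
      proof (cases i)
        case 0
        have wrap: "Suc (m - 1) = m"
          using m by simp
        then have "d = Suc (?D (m - 1) j) mod m"
          using twisted_residue_Suc[of m "m - 1" j] by (simp add: d_def 0 twisted_residue_wrap)
        then have "?D (m - 1) j mod 5 = 0"
          using m by (intro pred twisted_residue_less) auto
        then show ?thesis
          unfolding 0 by (intro defended_cylinder(6)[OF j wrap] code) auto
      next
        case (Suc i')
        then have "?D (i - 1) j mod 5 = 0"
          using m by (intro pred twisted_residue_less) (auto simp: d_def twisted_residue_Suc)
        then show ?thesis
          using Suc i j by (intro defended_cylinder(2) code) auto
      qed
    qed
    show "defended k (cylinder m n) f (i, j)"
    proof (cases d rule: mod_5_cases)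
      case 1
      then show ?thesis
        by (intro defended_self) (simp add: fd g_def)
    next
      case 2
      then show ?thesis
        by (rule down)
    next
      case 3
      show ?thesis
      proof (cases "Suc j < n")
        case True
        define e where "e = ?D i (Suc j)"
        have e: "d = (e + 2) mod m" "e < m"
          using m twisted_residue_Suc_right[of m i j] twisted_residue_less[of m i "Suc j"]
          unfolding d_def e_def by auto
        \<comment> \<open>A reduction modulo \<open>m\<close> would leave \<open>d < 2\<close>, but
          \<open>d mod 5 = 2\<close>.\<close>
        have "d = e + 2"
        proof (rule ccontr)
          assume "d \<noteq> e + 2"
          with e have "m \<le> e + 2"
            by (metis mod_less not_le)
          moreover have "e + 2 - m < m"
            using e m by simp
          ultimately have "d = e + 2 - m"
            unfolding e(1) by (simp only: le_mod_geq mod_less)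
          with e(2) have "d < 2"
            by simp
          with 3 show False
            by simp
        qed
        then have "e mod 5 = 0"
          using 3 by (simp add: mod_Suc split: if_splits)
        then show ?thesis
          using True i j by (intro defended_cylinder(3) code) (auto simp: e_def)
      next
        case last: False
        show ?thesis
        proof (cases "d + 2 = m")
          case True
          \<comment> \<open>The left neighbour has residue \<open>(d + 2) mod m = 0\<close>; it
            exists since \<open>n \<ge> 2\<close> separates the last column from the first.\<close>
          then show ?thesis
            using last i j n left by (intro defended_cylinder(4) code) auto
        next
          case False
          then show ?thesis
            using 3 last j by (intro defended_self) (simp add: fd g_def)
        qed
      qed
    next
      case 4
      then consider (top) "d + 1 = m" | (first) "d + 1 \<noteq> m" "j = 0" | (inner) "d + 1 \<noteq> m" "0 < j"
        by auto
      then show ?thesis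
      proof cases
        case top
        then show ?thesis
          by (intro up) simp
      next
        case first
        then show ?thesis
          using 4 fd by (intro defended_self) (simp add: g_def)
      next
        case inner
        have "d + 2 < m"
        proof (rule ccontr)
          assume "\<not> d + 2 < m"
          with d inner have "d = 5 * t + 2"
            using m by simp
          with 4 show False
            using mod_mult_self4[of 5 t 2] by simp
        qed
        moreover have "(d + 2) mod 5 = 0"
          using 4 by (simp add: mod_Suc)
        ultimately show ?thesis
          using inner i j left by (intro defended_cylinder(4) code) auto
      qed
    next
      case 5
      have "Suc d \<noteq> m"
      proof
        assume "Suc d = m"
        then have "d = 5 * t + 3"
          using m by simp
        with 5 show False
          using mod_mult_self4[of 5 t 3] by simp
      qed
      then show ?thesis
        using d 5 by (intro up) (simp add: mod_Suc)
    qed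
  qed (use m in simp)
  also have "(\<Sum>j<n. \<Sum>i<m. f (i, j)) = (\<Sum>j<n. \<Sum>d<m. g d j)"
    unfolding f_def case_prod_conv
    using m by (intro sum.cong sum.reindex_bij_betw bij_betw_twisted_residue) auto
  also have "(\<Sum>j<n. \<Sum>d<m. g d j) = n * ((t + 1) * (k + 1)) + t * k + t * k"
  proof -
    obtain N where "n = Suc N"
      using n by (cases n) auto
    then show ?thesis
      unfolding col sum.distrib sum_distrib_left[symmetric] by (simp add: algebra_simps)
  qed
  finally show ?thesis
    by (simp add: algebra_simps)
qed

section \<open>Assembling the five residue classes over the reals\<close>

theorem theorem6:
  fixes k n m :: nat
  assumes "k \<ge> 2" and "n \<ge> 4" and "m \<ge> 3"
  shows
    "(m mod 5 = 0 \<longrightarrow>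
        real (roman_domination_number k (cycle_graph m \<box> path_graph n))
          \<le> real m / 5 * (real n * (real k + 1) + 2 * real k)) \<and>
     (m mod 5 = 1 \<longrightarrow>
        real (roman_domination_number k (cycle_graph m \<box> path_graph n))
          \<le> (real m + 4) / 5 * (real n * (real k + 1) + 2 * real k)
            - (4 * real k + 1) - 2 * (real k + 2) * of_int \<lfloor>(real n - 2) / 5\<rfloor>) \<and>
     (m mod 5 = 2 \<longrightarrow>
        real (roman_domination_number k (cycle_graph m \<box> path_graph n))
          \<le> (real m + 3) / 5 * (real n * (real k + 1) + 2 * real k)
            - 3 * real k - (real k + 3) * of_int \<lfloor>(real n - 2) / 5\<rfloor>) \<and>
     (m mod 5 = 3 \<longrightarrow>
        real (roman_domination_number k (cycle_graph m \<box> path_graph n))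
          \<le> (real m + 2) / 5 * (real n * (real k + 1) + 2 * real k)
            - 2 * real k - 2 * of_int \<lfloor>(real n - 2) / 5\<rfloor>) \<and>
     (m mod 5 = 4 \<longrightarrow>
        real (roman_domination_number k (cycle_graph m \<box> path_graph n))
          \<le> (real m + 1) / 5 * (real n * (real k + 1) + 2 * real k)
            - 2 * real k)"
proof -
  define q s t where "q = (n - 2) div 5" and "s = (n - 2) mod 5" and "t = m div 5"
  let ?R = "roman_domination_number k (cylinder m n)"
  have n: "n = 5 * q + (2 + s)" "s < 5"
    using assms(2) by (auto simp: q_def s_def)
  have "(real n - 2) / 5 = real (n - 2) / 5"
    using assms(2) by simp
  \<comment> \<open>The floor of a quotient of naturals is \<open>div\<close>, so it equals the
    number \<open>q\<close> of full periods.\<close>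
  then have q: "of_int \<lfloor>(real n - 2) / 5\<rfloor> = real q"
    by (simp only: q_def floor_divide_of_nat_eq[of "n - 2" 5, simplified])
  have m: "m = 5 * t + m mod 5"
    by (simp add: t_def)
  show ?thesis
    unfolding q
  proof (intro conjI impI)
    assume c: "m mod 5 = 0"
    have "?R \<le> t * (n * (k + 1) + 2 * k)"
      using assms m c by (intro cylinder_bound_0) auto
    then have "real ?R \<le> real (t * (n * (k + 1) + 2 * k))"
      by (simp only: of_nat_le_iff)
    moreover have "real m = 5 * real t"
      using m c by simp
    ultimately show "real ?R \<le> real m / 5 * (real n * (real k + 1) + 2 * real k)"
      by (simp add: algebra_simps)
  next
    assume c: "m mod 5 = 1"
    then have "0 < t"
      using assms(3) m by (cases t) auto
    then have "?R + (4 * k + 1) + 2 * (k + 2) * q \<le> (t + 1) * (n * (k + 1) + 2 * k)"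
      using assms n m c by (intro cylinder_bound_1) auto
    then have "real (?R + (4 * k + 1) + 2 * (k + 2) * q) \<le> real ((t + 1) * (n * (k + 1) + 2 * k))"
      by (simp only: of_nat_le_iff)
    moreover have "(real m + 4) / 5 = real t + 1"
      using m c by simp
    ultimately show "real ?R \<le> (real m + 4) / 5 * (real n * (real k + 1) + 2 * real k)
        - (4 * real k + 1) - 2 * (real k + 2) * real q"
      by (simp add: algebra_simps)
  next
    assume c: "m mod 5 = 2"
    then have "0 < t"
      using assms(3) m by (cases t) auto
    then have "?R + 3 * k + (k + 3) * q \<le> (t + 1) * (n * (k + 1) + 2 * k)"
      using assms n m c by (intro cylinder_bound_2) auto
    then have "real (?R + 3 * k + (k + 3) * q) \<le> real ((t + 1) * (n * (k + 1) + 2 * k))"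
      by (simp only: of_nat_le_iff)
    moreover have "(real m + 3) / 5 = real t + 1"
      using m c by simp
    ultimately show "real ?R \<le> (real m + 3) / 5 * (real n * (real k + 1) + 2 * real k)
        - 3 * real k - (real k + 3) * real q"
      by (simp add: algebra_simps)
  next
    assume c: "m mod 5 = 3"
    have "?R + 2 * k + 2 * q \<le> (t + 1) * (n * (k + 1) + 2 * k)"
      using assms n m c by (intro cylinder_bound_3) auto
    then have "real (?R + 2 * k + 2 * q) \<le> real ((t + 1) * (n * (k + 1) + 2 * k))"
      by (simp only: of_nat_le_iff)
    moreover have "(real m + 2) / 5 = real t + 1"
      using m c by simp
    ultimately show "real ?R \<le> (real m + 2) / 5 * (real n * (real k + 1) + 2 * real k)
        - 2 * real k - 2 * real q"
      by (simp add: algebra_simps)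
  next
    assume c: "m mod 5 = 4"
    have "?R + 2 * k \<le> (t + 1) * (n * (k + 1) + 2 * k)"
      using assms m c by (intro cylinder_bound_4) auto
    then have "real (?R + 2 * k) \<le> real ((t + 1) * (n * (k + 1) + 2 * k))"
      by (simp only: of_nat_le_iff)
    moreover have "(real m + 1) / 5 = real t + 1"
      using m c by simp
    ultimately show "real ?R \<le> (real m + 1) / 5 * (real n * (real k + 1) + 2 * real k)
        - 2 * real k"
      by (simp add: algebra_simps)
  qed
qed

end
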